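(* There is an absolute constant $c>0$ such that for all integers $n\ge1$ and $3\le w\le n/10$, there exists a length-$n$ width-$w$ read-once branching program over alphabet $\{0,1\}$ that computes $\mathsf{ApproxCount}[n,\Delta]$ for some $\Delta\le n/2-c\sqrt{nw}$.
   Context: A length-$n$ read-once branching program (ROBP) over a finite alphabet $\Sigma$ is a directed layered multigraph with layers $V_0,\dots,V_n$, $V_0=\{v_{\mathrm{start}}\}$; for $0\le i\le n-1$ each vertex of $V_i$ has $|\Sigma|$ outgoing edges into $V_{i+1}$ labeled by distinct elements of $\Sigma$; vertices of $V_n$ are labeled with outputs; every vertex is reachable by some input. An input follows from $v_{\mathrm{start}}$ the edges labeled $x_1,\dots,x_n$ and the program outputs the label of the final vertex. Width is $\max_i|V_i|$. $\mathsf{ApproxCount}[n,\Delta]$: on input $x\in\{0,1\}^n$ output a real $\hat S$ with $|\hat S-\sum_{i=1}^n x_i|\le\Delta$; a program computes it if its output is valid on every input. *)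

theory Defs
  imports Complex_Main
begin

text \<open>
  Inputs in \<open>\<Sigma>\<^sup>n\<close> are lists of length \<open>n\<close>, so the symbol \<open>x\<^sub>i\<close> for \<open>1 \<le> i \<le> n\<close> is \<open>x ! (i - 1)\<close>.
\<close>

definition inputs :: "nat \<Rightarrow> 'a set \<Rightarrow> 'a list set" where
  "inputs n \<Sigma> = {x. length x = n \<and> set x \<subseteq> \<Sigma>}"

text \<open>
  The outgoing edges of a vertex \<open>v\<close> carry each label of the alphabet exactly once, so they are
  given by the function sending a label \<open>a\<close> to the head \<open>edge P v a\<close> of the edge labeled \<open>a\<close>.
  Several labels may lead to the same head (parallel edges). Only \<open>layer P i\<close> for \<open>i \<le> n\<close> is
  meaningful, and \<open>out P v\<close> only for \<open>v \<in> layer P n\<close>.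
\<close>

record ('v, 'a, 'o) robp =
  start :: 'v
  layer :: "nat \<Rightarrow> 'v set"
  edge :: "'v \<Rightarrow> 'a \<Rightarrow> 'v"
  out :: "'v \<Rightarrow> 'o"

definition run :: "('v, 'a, 'o) robp \<Rightarrow> 'a list \<Rightarrow> 'v" where
  "run P x = foldl (edge P) (start P) x"

definition outcome :: "('v, 'a, 'o) robp \<Rightarrow> 'a list \<Rightarrow> 'o" where
  "outcome P x = out P (run P x)"

text \<open>
  Finiteness of the layers is not required separately: it follows from reachability and the
  finiteness of the alphabet.
\<close>

definition is_robp :: "nat \<Rightarrow> 'a set \<Rightarrow> ('v, 'a, 'o) robp \<Rightarrow> bool" where
  "is_robp n \<Sigma> P \<longleftrightarrow>
     finite \<Sigma> \<and>
     layer P 0 = {start P} \<and>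
     (\<forall>i\<le>n. \<forall>j\<le>n. i \<noteq> j \<longrightarrow> layer P i \<inter> layer P j = {}) \<and>
     (\<forall>i<n. \<forall>v\<in>layer P i. \<forall>a\<in>\<Sigma>. edge P v a \<in> layer P (Suc i)) \<and>
     (\<forall>i\<le>n. \<forall>v\<in>layer P i. \<exists>x\<in>inputs n \<Sigma>. run P (take i x) = v)"

definition width :: "nat \<Rightarrow> ('v, 'a, 'o) robp \<Rightarrow> nat" where
  "width n P = (MAX i\<in>{0..n}. card (layer P i))"

text \<open>A computational problem is given by the relation between inputs and their valid outputs.\<close>

definition computes ::
  "nat \<Rightarrow> 'a set \<Rightarrow> ('v, 'a, 'o) robp \<Rightarrow> ('a list \<Rightarrow> 'o \<Rightarrow> bool) \<Rightarrow> bool" where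
  "computes n \<Sigma> P R \<longleftrightarrow> (\<forall>x\<in>inputs n \<Sigma>. R x (outcome P x))"

definition ApproxCount :: "nat \<Rightarrow> real \<Rightarrow> nat list \<Rightarrow> real \<Rightarrow> bool" where
  "ApproxCount n \<Delta> x S \<longleftrightarrow> \<bar>S - real (\<Sum>i<n. x ! i)\<bar> \<le> \<Delta>"

end

theory Submission
  imports Defs "HOL-Library.Countable"
begin

text \<open>
  A vertex carries a pair \<open>(a, b)\<close> of lower bounds for the numbers of ones and zeros read so far;
  at the end it determines the number of ones up to \<open>(n - (a + b)) / 2\<close>. A layer may be replaced
  by any set of pairs such that every successor of an old pair dominates a new one.
  With \<open>w = j + 2\<close>, from the two pairs \<open>(0, B)\<close> and \<open>(A, 0)\<close> one can reach \<open>(0, B + j)\<close> and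
  \<open>(A, 0)\<close> in about \<open>A + j\<close> steps: a staircase of \<open>j\<close> corners of heights \<open>B, \<dots>, B + j - 1\<close> moves to
  the right until the pair \<open>(A, 0)\<close> absorbs it. Alternating the two coordinates, \<open>A\<close> and \<open>B\<close>
  grow by \<open>j\<close> in \<open>O(A + j)\<close> steps, hence reach order \<open>sqrt (n * j)\<close> after \<open>n\<close> steps.
  The first \<open>w\<close> layers count exactly, so that the width is exactly \<open>w\<close>.
\<close>

section \<open>Bound steps and the moving staircase\<close>

definition bound_step :: "nat \<Rightarrow> ((nat \<times> nat) set \<times> (nat \<times> nat) set) set" where
  "bound_step w = {(S, S'). finite S' \<and> card S' \<le> w \<and>
     (\<forall>(a, b)\<in>S. (\<exists>(c, d)\<in>S'. c \<le> a + 1 \<and> d \<le> b) \<and> (\<exists>(c, d)\<in>S'. c \<le> a \<and> d \<le> b + 1))}"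

definition exact_layer :: "nat \<Rightarrow> (nat \<times> nat) set" where
  "exact_layer i = (\<lambda>a. (a, i - a)) ` {..i}"

definition corners :: "nat \<Rightarrow> nat \<Rightarrow> (nat \<times> nat) set" where
  "corners A B = {(0, B), (A, 0)}"

text \<open>\<open>t\<close> counts the steps since the staircase was entered. By truncated
  subtraction a corner with \<open>i \<ge> t\<close> is \<open>(0, B + i)\<close>; it dominates the
  top pair \<open>(0, B + min t j)\<close>, so corners not yet created are harmless and one formula
  serves all \<open>t\<close>.\<close>

definition staircase :: "nat \<Rightarrow> nat \<Rightarrow> nat \<Rightarrow> nat \<Rightarrow> (nat \<times> nat) set" where
  "staircase j A B t = (\<lambda>i. (t - i, B + i)) ` {..<j} \<union> {(0, B + min t j), (A, 0)}"

lemma bound_stepI: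
  assumes "finite S'" "card S' \<le> w"
    and "\<And>a b. (a, b) \<in> S \<Longrightarrow> \<exists>(c, d)\<in>S'. c \<le> a + 1 \<and> d \<le> b"
    and "\<And>a b. (a, b) \<in> S \<Longrightarrow> \<exists>(c, d)\<in>S'. c \<le> a \<and> d \<le> b + 1"
  shows "(S, S') \<in> bound_step w"
  using assms unfolding bound_step_def by blast

lemma bound_step_subset:
  assumes "finite S'" "card S' \<le> w" "S \<subseteq> S'"
  shows "(S, S') \<in> bound_step w"
proof (rule bound_stepI[OF assms(1,2)])
  fix a b assume "(a, b) \<in> S"
  then have "(a, b) \<in> S'" using assms(3) by blast
  then show "\<exists>(c, d)\<in>S'. c \<le> a + 1 \<and> d \<le> b" "\<exists>(c, d)\<in>S'. c \<le> a \<and> d \<le> b + 1"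
    by (auto intro!: bexI[of _ "(a, b)"])
qed

lemma finite_staircase: "finite (staircase j A B t)"
  by (simp add: staircase_def)

lemma card_staircase: "card (staircase j A B t) \<le> j + 2"
proof -
  have "card (staircase j A B t)
      \<le> card ((\<lambda>i. (t - i, B + i)) ` {..<j}) + card {(0, B + min t j), (A, 0)}"
    unfolding staircase_def by (rule card_Un_le)
  also have "card ((\<lambda>i. (t - i, B + i)) ` {..<j}) \<le> j"
    using card_image_le[of "{..<j}" "\<lambda>i. (t - i, B + i)"] by simp
  also have "card {(0, B + min t j), (A, 0)} \<le> 2"
    by (simp add: card_insert_if)
  finally show ?thesis by simp
qed

lemma finite_corners: "finite (corners A B)"
  and card_corners: "card (corners A B) \<le> j + 2"
  by (simp_all add: corners_def card_insert_if)

text \<open>A one takes corner \<open>i\<close> to corner \<open>i\<close> of the next staircase, a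
  zero takes it to corner \<open>i + 1\<close> because \<open>t - i = Suc t - Suc i\<close>; a zero
  at the last corner falls back to the top pair. While \<open>t < j\<close>, a one at the top pair
  creates corner \<open>t\<close>.\<close>

lemma staircase_step: "(staircase j A B t, staircase j A B (Suc t)) \<in> bound_step (j + 2)"
proof (rule bound_stepI[OF finite_staircase card_staircase])
  let ?S' = "staircase j A B (Suc t)"
  have top: "(0, B + min (Suc t) j) \<in> ?S'" and right: "(A, 0) \<in> ?S'"
    by (auto simp: staircase_def)
  have mid: "(Suc t - i, B + i) \<in> ?S'" if "i < j" for i
    using that by (auto simp: staircase_def)
  fix a b assume "(a, b) \<in> staircase j A B t"
  then consider (M) i where "i < j" "a = t - i" "b = B + i"
    | (T) "a = 0" "b = B + min t j" | (R) "a = A" "b = 0"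
    by (auto simp: staircase_def)
  note cases = this
  from cases show "\<exists>(c, d)\<in>?S'. c \<le> a + 1 \<and> d \<le> b"
  proof cases
    case M
    show ?thesis
    proof (cases "i \<le> t")
      case True
      then show ?thesis using M by (intro bexI[OF _ mid[OF \<open>i < j\<close>]]) auto
    next
      case False
      then show ?thesis using M by (intro bexI[OF _ top]) auto
    qed
  next
    case T
    show ?thesis
    proof (cases "t < j")
      case True
      then show ?thesis using T by (intro bexI[OF _ mid[OF True]]) auto
    next
      case False
      then show ?thesis using T by (intro bexI[OF _ top]) auto
    qed
  next
    case R
    then show ?thesis by (intro bexI[OF _ right]) auto
  qed
  from cases show "\<exists>(c, d)\<in>?S'. c \<le> a \<and> d \<le> b + 1"
  proof cases
    case M
    show ?thesis
    proof (cases "Suc i < j")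
      case True
      then show ?thesis using M by (intro bexI[OF _ mid[OF True]]) auto
    next
      case False
      then show ?thesis using M by (intro bexI[OF _ top]) auto
    qed
  next
    case T
    then show ?thesis by (intro bexI[OF _ top]) auto
  next
    case R
    then show ?thesis by (intro bexI[OF _ right]) auto
  qed
qed

text \<open>At \<open>t = A + j - 1\<close> the leftmost corner \<open>i = j - 1\<close> has first
  coordinate \<open>A\<close>, so every corner dominates \<open>(A, 0)\<close>. Moreover
  \<open>A \<ge> 1\<close> gives \<open>t \<ge> j\<close>, so the top pair has reached height
  \<open>B + j\<close>.\<close>

lemma staircase_absorbed:
  assumes "A \<ge> 1" "A + j = Suc t"
  shows "(staircase j A B t, corners A (B + j)) \<in> bound_step (j + 2)"
proof (rule bound_stepI[OF finite_corners card_corners])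
  fix a b assume "(a, b) \<in> staircase j A B t"
  then have "A \<le> a \<or> b = B + j"
    using assms by (auto simp: staircase_def)
  then show "\<exists>(c, d)\<in>corners A (B + j). c \<le> a + 1 \<and> d \<le> b"
    and "\<exists>(c, d)\<in>corners A (B + j). c \<le> a \<and> d \<le> b + 1"
    by (auto simp: corners_def)
qed

text \<open>One step enters the staircase, \<open>A + j - 1\<close> steps move it and one step
  absorbs it.\<close>

lemma raise_corner:
  assumes "A \<ge> 1"
  shows "(corners A B, corners A (B + j)) \<in> bound_step (j + 2) ^^ (A + j + 1)"
proof -
  obtain t where t: "A + j = Suc t" using assms by (cases A) auto
  have "(corners A B, staircase j A B 0) \<in> bound_step (j + 2)"
    by (rule bound_step_subset[OF finite_staircase card_staircase])
      (auto simp: corners_def staircase_def)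
  moreover have "(staircase j A B 0, staircase j A B t) \<in> bound_step (j + 2) ^^ t"
    by (rule relpow_fun_conv[THEN iffD2], rule exI[of _ "staircase j A B"]) (use staircase_step in simp)
  ultimately have "(corners A B, staircase j A B t) \<in> bound_step (j + 2) ^^ Suc t"
    by (blast intro: relpow_Suc_I2)
  then show ?thesis
    using staircase_absorbed[OF assms t, of B] t by auto
qed

section \<open>Exchanging ones and zeros, and repeated rounds\<close>

lemma swap_bound_step:
  assumes "(S, S') \<in> bound_step w"
  shows "(prod.swap ` S, prod.swap ` S') \<in> bound_step w"
proof (rule bound_stepI)
  show "finite (prod.swap ` S')" "card (prod.swap ` S') \<le> w"
    using assms card_image_le[of S' prod.swap] by (auto simp: bound_step_def)
next
  fix a b assume "(a, b) \<in> prod.swap ` S"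
  then have "(b, a) \<in> S" by auto
  then obtain c d c' d' where "(c, d) \<in> S'" "c \<le> b + 1" "d \<le> a"
    and "(c', d') \<in> S'" "c' \<le> b" "d' \<le> a + 1"
    using assms unfolding bound_step_def by blast
  then show "\<exists>(c, d)\<in>prod.swap ` S'. c \<le> a + 1 \<and> d \<le> b"
    and "\<exists>(c, d)\<in>prod.swap ` S'. c \<le> a \<and> d \<le> b + 1"
    by force+
qed

lemma swap_bound_step_power:
  "(S, S') \<in> bound_step w ^^ t \<Longrightarrow> (prod.swap ` S, prod.swap ` S') \<in> bound_step w ^^ t"
  by (induction t arbitrary: S') (auto intro: relcompI swap_bound_step)

lemma swap_corners: "prod.swap ` corners A B = corners B A"
  by (auto simp: corners_def)

text \<open>The second half is the first with the coordinates exchanged; it takes \<open>j\<close>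
  more steps because the absorbing pair is now at distance \<open>A + j\<close>.\<close>

lemma raise_both_corners:
  assumes "A \<ge> 1"
  shows "(corners A A, corners (A + j) (A + j)) \<in> bound_step (j + 2) ^^ (2 * A + 3 * j + 2)"
proof -
  have "(corners A A, corners A (A + j)) \<in> bound_step (j + 2) ^^ (A + j + 1)"
    using raise_corner[OF assms] .
  moreover have "(corners A (A + j), corners (A + j) (A + j))
      \<in> bound_step (j + 2) ^^ (A + j + j + 1)"
    using swap_bound_step_power[OF raise_corner[of "A + j" A j]] assms
    by (simp add: swap_corners)
  ultimately have "(corners A A, corners (A + j) (A + j))
      \<in> bound_step (j + 2) ^^ ((A + j + 1) + (A + j + j + 1))"
    unfolding relpow_add by blast
  moreover have "(A + j + 1) + (A + j + j + 1) = 2 * A + 3 * j + 2" by simp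
  ultimately show ?thesis by (simp only:)
qed

text \<open>The exponent is the sum of the round costs \<open>2 * (A + k * j) + 3 * j + 2\<close>
  over \<open>k < r\<close>. The level is linear in \<open>r\<close> and the cost quadratic, which
  is the source of the square root.\<close>

lemma raise_corners_iterated:
  assumes "A \<ge> 1"
  shows "(corners A A, corners (A + r * j) (A + r * j))
     \<in> bound_step (j + 2) ^^ (r * r * j + 2 * r * j + 2 * r * A + 2 * r)"
proof (induction r)
  case 0
  show ?case by simp
next
  case (Suc r)
  let ?A = "A + r * j"
  have "(corners ?A ?A, corners (?A + j) (?A + j))
      \<in> bound_step (j + 2) ^^ (2 * ?A + 3 * j + 2)"
    by (rule raise_both_corners) (use assms in simp)
  with Suc have "(corners A A, corners (?A + j) (?A + j))
      \<in> bound_step (j + 2) ^^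
        ((r * r * j + 2 * r * j + 2 * r * A + 2 * r) + (2 * ?A + 3 * j + 2))"
    unfolding relpow_add by blast
  moreover have "(r * r * j + 2 * r * j + 2 * r * A + 2 * r) + (2 * ?A + 3 * j + 2)
      = Suc r * Suc r * j + 2 * Suc r * j + 2 * Suc r * A + 2 * Suc r"
    by (simp add: algebra_simps)
  moreover have "?A + j = A + Suc r * j" by simp
  ultimately show ?case by (simp only:)
qed

text \<open>Spends the input symbols left over after the last round.\<close>

lemma corners_stay: "(corners A B, corners A B) \<in> bound_step (j + 2) ^^ t"
proof (induction t)
  case (Suc t)
  have "(corners A B, corners A B) \<in> bound_step (j + 2)"
    by (rule bound_step_subset[OF finite_corners card_corners]) simp
  with Suc show ?case by auto
qed simp

section \<open>Exact counting and the transition to corners\<close>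

lemma exact_layer_step:
  assumes "Suc i < w"
  shows "(exact_layer i, exact_layer (Suc i)) \<in> bound_step w"
proof (rule bound_stepI)
  show "finite (exact_layer (Suc i))" "card (exact_layer (Suc i)) \<le> w"
    using assms card_image_le[of "{..Suc i}" "\<lambda>a. (a, Suc i - a)"]
    by (auto simp: exact_layer_def)
next
  fix a b assume "(a, b) \<in> exact_layer i"
  then have "(a + 1, b) \<in> exact_layer (Suc i)" "(a, b + 1) \<in> exact_layer (Suc i)"
    by (auto simp: exact_layer_def image_iff)
  then show "\<exists>(c, d)\<in>exact_layer (Suc i). c \<le> a + 1 \<and> d \<le> b"
    and "\<exists>(c, d)\<in>exact_layer (Suc i). c \<le> a \<and> d \<le> b + 1"
    by (auto intro: bexI[of _ "(a + 1, b)"] bexI[of _ "(a, b + 1)"])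
qed

text \<open>A pair with both entries below \<open>A\<close> has sum at most
  \<open>2 * A - 2 \<le> i\<close>, hence equals \<open>(A - 1, A - 1)\<close>, and either symbol
  lifts one entry to \<open>A\<close>. All other pairs already dominate a corner.\<close>

lemma exact_layer_to_corners:
  assumes "2 * A \<le> i + 2"
  shows "(exact_layer i, corners A A) \<in> bound_step (j + 2)"
proof (rule bound_stepI[OF finite_corners card_corners])
  fix a b assume "(a, b) \<in> exact_layer i"
  then have "a + b = i" by (auto simp: exact_layer_def)
  with assms have "A \<le> a \<or> A \<le> b \<or> A = a + 1 \<and> A = b + 1" by linarith
  then show "\<exists>(c, d)\<in>corners A A. c \<le> a + 1 \<and> d \<le> b"
    and "\<exists>(c, d)\<in>corners A A. c \<le> a \<and> d \<le> b + 1"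
    by (auto simp: corners_def)
qed

section \<open>From bound steps to branching programs\<close>

lemma robp_of_bound_steps:
  fixes D :: real
  assumes w: "1 \<le> w" "w \<le> n"
    and steps: "\<And>i. i < n \<Longrightarrow> (S i, S (Suc i)) \<in> bound_step w"
    and exact: "\<And>i. i < w \<Longrightarrow> S i = exact_layer i"
    and final: "\<And>a b. (a, b) \<in> S n \<Longrightarrow> D \<le> real (a + b)"
  shows "\<exists>P :: (nat, nat, real) robp. is_robp n {0, 1} P \<and> width n P = w \<and>
    computes n {0, 1} P (ApproxCount n ((real n - D) / 2))"
proof -
  define succ_ok where "succ_ok i p x q \<longleftrightarrow>
      q \<in> S (Suc i) \<and> fst q \<le> fst p + x \<and> snd q \<le> snd p + (1 - x)"
    for i and p :: "nat \<times> nat" and x and q :: "nat \<times> nat"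
  define succ where "succ i p x = (SOME q. succ_ok i p x q)" for i p x
  have succ: "succ_ok i p x (succ i p x)" if "i < n" "p \<in> S i" "x \<in> {0, 1}" for i p x
  proof -
    obtain a b where p: "p = (a, b)" by fastforce
    have "\<exists>q. succ_ok i p x q"
      using steps[OF that(1)] that(2,3) unfolding bound_step_def succ_ok_def p by fastforce
    then show ?thesis unfolding succ_def by (rule someI_ex)
  qed
  \<comment> \<open>Storing the layer index in the vertex makes the layers disjoint and lets
    \<open>edge\<close> depend on the layer. The output is the midpoint of the interval from
    \<open>a\<close> to \<open>n - b\<close>, which contains the count.\<close>
  define P0 :: "(nat, nat, real) robp" where "P0 = \<lparr>
     start = to_nat (0::nat, (0::nat, 0::nat)),
     layer = (\<lambda>_. {}),
     edge = (\<lambda>v x. case from_nat v of (i, p) \<Rightarrow> to_nat (Suc i, succ i p x)),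
     out = (\<lambda>v. case from_nat v of (i::nat, (a, b)) \<Rightarrow> (real a + real n - real b) / 2)\<rparr>"
  \<comment> \<open>Some pairs of \<open>S i\<close> may never be reached, so the layers are taken
    to be the sets of reached vertices. Runs do not look at the \<open>layer\<close> field, so the
    empty layers of \<open>P0\<close> can be replaced afterwards.\<close>
  define P where "P = P0\<lparr>layer := \<lambda>i. run P0 ` inputs i {0, 1}\<rparr>"
  have run_P: "run P = run P0"
    by (simp add: P_def run_def fun_eq_iff)
  have layer_P: "layer P i = run P ` inputs i {0, 1}" for i
    unfolding run_P by (simp add: P_def)
  have edge_P: "edge P (to_nat (i, p)) x = to_nat (Suc i, succ i p x)" for i p x
    by (simp add: P_def P0_def)
  have run_bounds: "\<exists>a b. (a, b) \<in> S (length x) \<and> run P x = to_nat (length x, (a, b)) \<and>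
      a \<le> sum_list x \<and> b + sum_list x \<le> length x"
    if "set x \<subseteq> {0, 1}" "length x \<le> n" for x
    using that
  proof (induction x rule: rev_induct)
    case Nil
    then show ?case
      using exact[of 0] w by (simp add: exact_layer_def run_def P_def P0_def)
  next
    case (snoc y x)
    then obtain a b where ab: "(a, b) \<in> S (length x)" "run P x = to_nat (length x, (a, b))"
      "a \<le> sum_list x" "b + sum_list x \<le> length x" by auto
    obtain c d where cd: "succ (length x) (a, b) y = (c, d)" by fastforce
    have y: "y \<in> {0, 1}" using snoc.prems by auto
    have ok: "succ_ok (length x) (a, b) y (c, d)"
      using succ[OF _ ab(1) y] snoc.prems cd by simp
    have "run P (x @ [y]) = to_nat (Suc (length x), (c, d))"
      using ab(2) edge_P[of "length x" "(a, b)" y] cd by (simp add: run_def)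
    then show ?case
      using ok ab(3,4) y unfolding succ_ok_def by auto
  qed
  have layer_sub: "layer P i \<subseteq> (\<lambda>p. to_nat (i, p)) ` S i" if "i \<le> n" for i
    using run_bounds that by (fastforce simp: layer_P inputs_def)
  have S_fin: "finite (S i) \<and> card (S i) \<le> w" if "i \<le> n" for i
  proof (cases i)
    case 0
    then show ?thesis using exact[of 0] w by (simp add: exact_layer_def)
  next
    case (Suc k)
    then show ?thesis using steps[of k] that by (simp add: bound_step_def)
  qed
  have card_le: "card (layer P i) \<le> w" if "i \<le> n" for i
  proof -
    have "card (layer P i) \<le> card ((\<lambda>p. to_nat (i, p)) ` S i)"
      using layer_sub[OF that] S_fin[OF that] by (intro card_mono) auto
    also have "\<dots> \<le> card (S i)" using S_fin[OF that] by (intro card_image_le) auto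
    finally show ?thesis using S_fin[OF that] by simp
  qed
  \<comment> \<open>Layers may be smaller than \<open>S i\<close>, so the width has to be attained
    somewhere. In layer \<open>w - 1\<close> the two lower bounds sum to the number of symbols read,
    hence are exact, and the \<open>w\<close> possible counts lead to distinct vertices.\<close>
  have card_w: "card (layer P (w - 1)) = w"
  proof -
    have "to_nat (w - 1, (a, w - 1 - a)) \<in> layer P (w - 1)" if "a \<le> w - 1" for a
    proof -
      define x :: "nat list" where "x = replicate a 1 @ replicate (w - 1 - a) 0"
      have x: "length x = w - 1" "set x \<subseteq> {0, 1}" "sum_list x = a"
        using that by (auto simp: x_def sum_list_replicate)
      obtain c d where cd: "(c, d) \<in> S (w - 1)" "run P x = to_nat (w - 1, (c, d))"
        "c \<le> a" "d + a \<le> w - 1"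
        using run_bounds[OF x(2)] x(1,3) w by (metis diff_le_self le_trans)
      have "c + d = w - 1" using cd(1) exact[of "w - 1"] w by (auto simp: exact_layer_def)
      then have "c = a" "d = w - 1 - a" using cd by auto
      then show ?thesis
        using cd(2) x unfolding layer_P inputs_def by (metis (mono_tags) imageI mem_Collect_eq)
    qed
    then have "(\<lambda>a. to_nat (w - 1, (a, w - 1 - a))) ` {..w - 1} \<subseteq> layer P (w - 1)" by auto
    moreover have "finite (layer P (w - 1))"
      using layer_sub[of "w - 1"] S_fin[of "w - 1"] w finite_subset by fastforce
    ultimately have "card ((\<lambda>a. to_nat (w - 1, (a, w - 1 - a))) ` {..w - 1})
        \<le> card (layer P (w - 1))"
      by (intro card_mono)
    moreover have "inj_on (\<lambda>a. to_nat (w - 1, (a, w - 1 - a))) {..w - 1}"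
      by (auto simp: inj_on_def)
    ultimately have "w \<le> card (layer P (w - 1))"
      using w by (simp add: card_image)
    then show ?thesis using card_le[of "w - 1"] w by simp
  qed
  have "width n P = w"
    unfolding width_def
  proof (rule Max_eqI)
    show "w \<in> (\<lambda>i. card (layer P i)) ` {0..n}"
      using card_w w by (intro image_eqI[of _ _ "w - 1"]) auto
  qed (use card_le in auto)
  moreover have "is_robp n {0, 1} P"
    unfolding is_robp_def
  proof (intro conjI allI impI ballI)
    show "layer P 0 = {start P}" by (auto simp: layer_P inputs_def run_def)
    show "layer P i \<inter> layer P j = {}" if "i \<le> n" "j \<le> n" "i \<noteq> j" for i j
      using layer_sub[OF that(1)] layer_sub[OF that(2)] that(3)
      by (auto simp: disjoint_iff dest!: subsetD)
    show "edge P v a \<in> layer P (Suc i)" if v: "v \<in> layer P i" and a: "a \<in> {0, 1}" for i v a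
    proof -
      obtain x where "x \<in> inputs i {0, 1}" "v = run P x" using v by (auto simp: layer_P)
      then have "edge P v a = run P (x @ [a])" "x @ [a] \<in> inputs (Suc i) {0, 1}"
        using a by (auto simp: run_def inputs_def)
      then show ?thesis by (simp add: layer_P)
    qed
    show "\<exists>x\<in>inputs n {0, 1}. run P (take i x) = v" if "i \<le> n" and v: "v \<in> layer P i" for i v
    proof -
      obtain x where "x \<in> inputs i {0, 1}" "v = run P x" using v by (auto simp: layer_P)
      then show ?thesis using that
        by (intro bexI[of _ "x @ replicate (n - i) 0"]) (auto simp: inputs_def)
    qed
  qed simp
  moreover have "computes n {0, 1} P (ApproxCount n ((real n - D) / 2))"
    unfolding computes_def ApproxCount_def
  proof
    fix x :: "nat list" assume "x \<in> inputs n {0, 1}"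
    then have x: "length x = n" "set x \<subseteq> {0, 1}" by (auto simp: inputs_def)
    then obtain a b where ab: "(a, b) \<in> S n" "run P x = to_nat (n, (a, b))"
      "a \<le> sum_list x" "b + sum_list x \<le> n"
      using run_bounds[of x] by auto
    have "(\<Sum>i<n. x ! i) = sum_list x"
      using x by (simp add: sum_list_sum_nth atLeast0LessThan)
    moreover have "outcome P x = (real a + real n - real b) / 2"
      using ab(2) by (simp add: outcome_def P_def P0_def)
    moreover have "real a \<le> real (sum_list x)" "real b + real (sum_list x) \<le> real n"
      using ab(3,4) by linarith+
    moreover have "D \<le> real a + real b" using final[OF ab(1)] by simp
    ultimately show "\<bar>outcome P x - real (\<Sum>i<n. x ! i)\<bar> \<le> (real n - D) / 2"
      by (simp only: abs_le_iff) (simp add: field_simps)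
  qed
  ultimately show ?thesis by blast
qed

text \<open>Exact counting fills layers \<open>0\<close> to \<open>j + 1\<close>, the next step
  enters the corners, and the remaining \<open>n - (j + 2)\<close> steps follow the given path and
  then idle. The bound on \<open>A\<close> is what leaving the exact layer \<open>j + 1\<close>
  requires.\<close>

lemma robp_of_corners:
  assumes A: "2 * A \<le> j + 3"
    and path: "(corners A A, corners B B) \<in> bound_step (j + 2) ^^ t" and n: "j + 2 + t \<le> n"
  shows "\<exists>P :: (nat, nat, real) robp. is_robp n {0, 1} P \<and> width n P = j + 2 \<and>
    computes n {0, 1} P (ApproxCount n ((real n - real B) / 2))"
proof -
  define m where "m = n - (j + 2)"
  have m: "t + (m - t) = m" and nm: "n = j + 2 + m" using n by (simp_all add: m_def)
  have "(corners A A, corners B B) \<in> bound_step (j + 2) ^^ (t + (m - t))"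
    unfolding relpow_add using path corners_stay by (rule relcompI)
  then have "(corners A A, corners B B) \<in> bound_step (j + 2) ^^ m"
    by (simp only: m)
  then obtain f where f: "f 0 = corners A A" "f m = corners B B"
    "\<And>i. i < m \<Longrightarrow> (f i, f (Suc i)) \<in> bound_step (j + 2)"
    unfolding relpow_fun_conv by blast
  define S where "S i = (if i < j + 2 then exact_layer i else f (i - (j + 2)))" for i
  show ?thesis
  proof (rule robp_of_bound_steps[where S = S and D = "real B"])
    fix i assume "i < n"
    consider "Suc i < j + 2" | "i = j + 1" | "j + 2 \<le> i" by linarith
    then show "(S i, S (Suc i)) \<in> bound_step (j + 2)"
    proof cases
      case 1
      then show ?thesis using exact_layer_step[OF 1] by (simp add: S_def)
    next
      case 2
      then show ?thesis using exact_layer_to_corners[of A "j + 1" j] A f(1) by (simp add: S_def)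
    next
      case 3
      then obtain k where k: "i = j + 2 + k" using le_Suc_ex by blast
      then have "k < m" using \<open>i < n\<close> nm by simp
      then show ?thesis using f(3)[of k] by (simp add: S_def k)
    qed
  next
    fix a b assume "(a, b) \<in> S n"
    moreover have "S n = f m"
      unfolding nm S_def by simp
    ultimately have "(a, b) \<in> corners B B"
      by (simp only: f(2))
    then have "B \<le> a + b"
      unfolding corners_def by auto
    then show "real B \<le> real (a + b)"
      by (rule of_nat_mono)
  next
    show "1 \<le> j + 2" "j + 2 \<le> n" using n by simp_all
  next
    fix i assume "i < j + 2"
    then show "S i = exact_layer i" by (simp only: S_def if_True)
  qed
qed

section \<open>Number of rounds and constants\<close>

lemma exists_round_count:
  fixes n j :: nat
  assumes "j \<ge> 1" "j + 2 \<le> n"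
  obtains r where "j + 2 + j * (r * r + 7 * r) \<le> n" "n \<le> 11 * j * ((r + 1) * (r + 1))"
proof -
  \<comment> \<open>\<open>r\<close> is the largest number of rounds whose cost estimate still fits
    into \<open>n\<close>; the failure of \<open>r + 1\<close> yields the upper bound on
    \<open>n\<close>.\<close>
  let ?Q = "\<lambda>r. j + 2 + j * (r * r + 7 * r) \<le> n"
  have bound: "r \<le> n" if "?Q r" for r
  proof -
    have "r \<le> j * (r * r + 7 * r)" using assms by (cases j) auto
    with that show ?thesis by linarith
  qed
  define r where "r = Greatest ?Q"
  have "?Q 0" using assms by simp
  then have Q: "?Q r" unfolding r_def by (rule GreatestI_nat) (rule bound)
  have "r + 1 \<le> r" if "?Q (r + 1)"
    using that unfolding r_def by (rule Greatest_le_nat) (rule bound)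
  then have "\<not> ?Q (r + 1)" by linarith
  then have "n \<le> j + 2 + j * ((r + 1) * (r + 1) + 7 * (r + 1))" by simp
  also have "\<dots> \<le> 3 * j + j * ((r + 1) * (r + 1) + 7 * (r + 1))" using assms by simp
  also have "\<dots> = j * ((r + 1) * (r + 1) + 7 * (r + 1) + 3)" by (simp add: algebra_simps)
  \<comment> \<open>Here \<open>11 = 1 + 7 + 3\<close>, using \<open>r + 1 \<ge> 1\<close>.\<close>
  also have "\<dots> \<le> j * (11 * ((r + 1) * (r + 1)))" by (intro mult_left_mono) simp_all
  also have "\<dots> = 11 * j * ((r + 1) * (r + 1))" by (simp only: ac_simps)
  finally show thesis using Q that by blast
qed

theorem theorem6p1:
  "\<exists>c::real. c > 0 \<and>
     (\<forall>n w :: nat. n \<ge> 1 \<longrightarrow> 3 \<le> w \<longrightarrow> real w \<le> real n / 10 \<longrightarrow>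
       (\<exists>(P :: (nat, nat, real) robp) (\<Delta> :: real).
          is_robp n {0, 1} P \<and> width n P = w \<and>
          \<Delta> \<le> real n / 2 - c * sqrt (real n * real w) \<and>
          computes n {0, 1} P (ApproxCount n \<Delta>)))"
proof (intro exI[of _ "1/24"] conjI allI impI)
  fix n w :: nat
  assume "3 \<le> w" and wn: "real w \<le> real n / 10"
  define j where "j = w - 2"
  have w: "w = j + 2" and j: "j \<ge> 1" and n: "j + 2 \<le> n"
    using \<open>3 \<le> w\<close> wn by (auto simp: j_def)
  obtain r where r: "j + 2 + j * (r * r + 7 * r) \<le> n" "n \<le> 11 * j * ((r + 1) * (r + 1))"
    using exists_round_count[OF j n] .
  \<comment> \<open>A level of about \<open>j / 2\<close> can be entered directly from exact
    counting. With \<open>j \<le> 2 * A\<close> the final level is at least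
    \<open>j * (r + 1) / 2\<close>, which is of the right order even if no round fits.\<close>
  define A where "A = j div 2 + 1"
  have A: "A \<ge> 1" "2 * A \<le> j + 2" "j \<le> 2 * A" by (auto simp: A_def)
  have "2 * r * A + 2 * r = r * (2 * A + 2)" by (simp add: algebra_simps)
  \<comment> \<open>Since \<open>2 * A + 2 \<le> j + 4 \<le> 5 * j\<close>; together with
    \<open>2 * r * j\<close> this gives the coefficient 7.\<close>
  also have "\<dots> \<le> r * (5 * j)" using A j by (intro mult_left_mono) auto
  finally have rounds: "r * r * j + 2 * r * j + 2 * r * A + 2 * r \<le> j * (r * r + 7 * r)"
    by (simp add: algebra_simps)
  obtain P :: "(nat, nat, real) robp" where P: "is_robp n {0, 1} P" "width n P = j + 2"
    "computes n {0, 1} P (ApproxCount n ((real n - real (A + r * j)) / 2))"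
    using robp_of_corners[OF _ raise_corners_iterated[OF A(1), of r j], of n] A r rounds by auto
  \<comment> \<open>The constant arises from
    \<open>sqrt (n * w) \<le> 6 * j * (r + 1) \<le> 12 * (A + r * j)\<close>, while the error drops
    below \<open>n / 2\<close> by half of \<open>A + r * j\<close>.\<close>
  have "n * w \<le> (11 * j * ((r + 1) * (r + 1))) * (3 * j)"
    using r(2) w j by (intro mult_mono) auto
  also have "\<dots> = 33 * (j * (r + 1))\<^sup>2" by (simp add: power2_eq_square algebra_simps)
  also have "\<dots> \<le> (6 * j * (r + 1))\<^sup>2" unfolding mult.assoc power_mult_distrib[of 6] by simp
  finally have "real (n * w) \<le> real ((6 * j * (r + 1))\<^sup>2)" by (rule of_nat_mono)
  then have "sqrt (real n * real w) \<le> real (6 * j * (r + 1))"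
    by (intro real_le_lsqrt) auto
  moreover have "j * (r + 1) \<le> 2 * (A + r * j)" using A by (simp add: algebra_simps)
  then have "real (j * (r + 1)) \<le> real (2 * (A + r * j))" by (rule of_nat_mono)
  ultimately have "(real n - real (A + r * j)) / 2 \<le> real n / 2 - 1 / 24 * sqrt (real n * real w)"
    by (simp add: field_simps)
  then show "\<exists>(P :: (nat, nat, real) robp) (\<Delta> :: real).
          is_robp n {0, 1} P \<and> width n P = w \<and>
          \<Delta> \<le> real n / 2 - 1 / 24 * sqrt (real n * real w) \<and>
          computes n {0, 1} P (ApproxCount n \<Delta>)"
    using P w by blast
qed simp

end
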